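(* Let $X$ be a complex Banach space and let $P$ be a bounded linear projection on $X$ such that $P+\lambda(I-P)=T$, where $\lambda\in\mathbb{T}\setminus\{1\}$ and $T$ is an isometry on $X$. Then $P=\frac{I+R}{2}$, where $R$ is a reflection on $X$ belonging to the algebra generated by $T$.
   Context: $\mathbb{T}$ denotes the set of complex numbers of modulus $1$, and $I$ is the identity operator on $X$. A projection is a bounded linear operator $P$ with $P^2=P$. A reflection on $X$ is a bounded linear operator $R$ on $X$ with $R^2=I$ (not necessarily an isometry). The algebra generated by $T$ is the set of polynomials in $T$ with complex coefficients. *)

theory Defs
  imports Complex_Main "HOL-Computational_Algebra.Polynomial"
begin

text \<open>
  A complex Banach space is a real Banach space with a complex scalar multiplication that extends
  the real one and for which the norm is homogeneous. The law \<open>1 *\<^sub>C x = x\<close> follows from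
  \<open>scaleC_of_real\<close>.
\<close>

class complex_banach = banach +
  fixes scaleC :: "complex \<Rightarrow> 'a \<Rightarrow> 'a" (infixr "*\<^sub>C" 75)
  assumes scaleC_add_right: "c *\<^sub>C (x + y) = c *\<^sub>C x + c *\<^sub>C y"
    and scaleC_add_left: "(c + d) *\<^sub>C x = c *\<^sub>C x + d *\<^sub>C x"
    and scaleC_scaleC: "c *\<^sub>C (d *\<^sub>C x) = (c * d) *\<^sub>C x"
    and scaleC_of_real: "complex_of_real r *\<^sub>C x = r *\<^sub>R x"
    and norm_scaleC: "norm (c *\<^sub>C x) = cmod c * norm x"

instantiation complex :: complex_banach
begin

definition scaleC_complex :: "complex \<Rightarrow> complex \<Rightarrow> complex" where
  "scaleC_complex c x = c * x"

instance
  by standard (simp_all add: scaleC_complex_def algebra_simps norm_mult scaleR_conv_of_real)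

end

text \<open>The library predicate \<open>bounded_linear\<close> only asks for real linearity.\<close>

definition bounded_operator :: "('a::complex_banach \<Rightarrow> 'a) \<Rightarrow> bool" where
  "bounded_operator T \<longleftrightarrow> bounded_linear T \<and> (\<forall>c x. T (c *\<^sub>C x) = c *\<^sub>C T x)"

definition is_projection :: "('a::complex_banach \<Rightarrow> 'a) \<Rightarrow> bool" where
  "is_projection P \<longleftrightarrow> bounded_operator P \<and> P \<circ> P = P"

definition is_reflection :: "('a::complex_banach \<Rightarrow> 'a) \<Rightarrow> bool" where
  "is_reflection R \<longleftrightarrow> bounded_operator R \<and> R \<circ> R = id"

definition is_isometry :: "('a::complex_banach \<Rightarrow> 'a) \<Rightarrow> bool" where
  "is_isometry T \<longleftrightarrow> (\<forall>x y. dist (T x) (T y) = dist x y)"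

definition poly_op :: "complex poly \<Rightarrow> ('a::complex_banach \<Rightarrow> 'a) \<Rightarrow> 'a \<Rightarrow> 'a" where
  "poly_op p T = (\<lambda>x. \<Sum>i\<le>degree p. coeff p i *\<^sub>C (T ^^ i) x)"

text \<open>Polynomials may have a constant term, so the generated algebra contains the identity.\<close>

definition generated_algebra :: "('a::complex_banach \<Rightarrow> 'a) \<Rightarrow> ('a \<Rightarrow> 'a) set" where
  "generated_algebra T = range (\<lambda>p. poly_op p T)"

end

theory Submission
  imports Defs
begin

text \<open>
  On the range of \<open>P\<close> the operator \<open>T\<close> acts as \<open>1\<close>, and on the kernel as \<open>l\<close>. The reflection
  \<open>R = 2P - I\<close>, the only operator with \<open>P = (I + R) / 2\<close>, acts there as \<open>1\<close> and \<open>-1\<close>. Since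
  \<open>l \<noteq> 1\<close>, there is a polynomial \<open>p\<close> of degree one with \<open>p(1) = 1\<close> and \<open>p(l) = -1\<close>,
  and therefore \<open>R = p(T)\<close>. Equivalently, \<open>T = (1 - l) P + l I\<close> is solved for \<open>P\<close>, and the
  solution is substituted into \<open>2P - I\<close>. That \<open>R\<close> squares to \<open>I\<close> is a restatement of
  \<open>P\<^sup>2 = P\<close> (\<open>is_reflection_of_projection\<close>).
\<close>

interpretation complex_module: module "scaleC :: complex \<Rightarrow> 'a \<Rightarrow> 'a::complex_banach"
proof
  show "1 *\<^sub>C x = x" for x :: 'a
    using scaleC_of_real[of 1 x] by simp
qed (rule scaleC_add_right scaleC_add_left scaleC_scaleC)+

lemma scaleC_two: "2 *\<^sub>C x = x + x"
  using scaleC_add_left[of 1 1 x] by simp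

text \<open>
  The polynomial operator is a sum up to the degree, and the degree of \<open>[:d, c:]\<close> drops to \<open>0\<close>
  for \<open>c = 0\<close>; the formula survives because the lost term vanishes.
\<close>

lemma poly_op_linear: "poly_op [:d, c:] T = (\<lambda>x. d *\<^sub>C x + c *\<^sub>C T x)"
  by (cases "c = 0") (simp_all add: poly_op_def fun_eq_iff)

lemma is_reflection_of_projection:
  fixes P :: "'a::complex_banach \<Rightarrow> 'a"
  assumes "is_projection P"
  shows "is_reflection (\<lambda>x. 2 *\<^sub>C P x - x)"
proof -
  have bl: "bounded_linear P" and hom: "P (c *\<^sub>C x) = c *\<^sub>C P x" and idem: "P (P x) = P x" for c x
    using assms by (auto simp: is_projection_def bounded_operator_def fun_eq_iff)
  interpret P: bounded_linear P by (rule bl)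
  have "bounded_linear (\<lambda>x. 2 *\<^sub>C P x - x)"
    unfolding scaleC_two
    by (intro bounded_linear_sub bounded_linear_add bl bounded_linear_ident)
  moreover have "2 *\<^sub>C P (c *\<^sub>C x) - c *\<^sub>C x = c *\<^sub>C (2 *\<^sub>C P x - x)" for c x
    by (simp add: hom complex_module.scale_right_diff_distrib mult.commute)
  moreover have "2 *\<^sub>C P (2 *\<^sub>C P x - x) - (2 *\<^sub>C P x - x) = x" for x
    by (simp add: scaleC_two P.diff P.add idem)
  ultimately show ?thesis
    by (simp add: is_reflection_def bounded_operator_def fun_eq_iff)
qed

theorem proposition2p1:
  fixes P T :: "'a::complex_banach \<Rightarrow> 'a" and l :: complex
  assumes "is_projection P"
    and "cmod l = 1" and "l \<noteq> 1"
    and "(\<lambda>x. P x + l *\<^sub>C (x - P x)) = T"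
    and "is_isometry T"
  shows "\<exists>R. is_reflection R \<and> R \<in> generated_algebra T \<and> P = (\<lambda>x. (1 / 2) *\<^sub>C (x + R x))"
proof (intro exI conjI)
  let ?R = "\<lambda>x. 2 *\<^sub>C P x - x"
  show "is_reflection ?R"
    by (rule is_reflection_of_projection) fact
  show "P = (\<lambda>x. (1 / 2) *\<^sub>C (x + ?R x))"
    by simp
  \<comment> \<open>The polynomial \<open>c z + d\<close> takes the value \<open>1\<close> at \<open>1\<close> and \<open>-1\<close> at \<open>l\<close>.\<close>
  define c d where "c = 2 / (1 - l)" and "d = - (1 + l) / (1 - l)"
  have c: "c - c * l = 2" and d: "d + c * l = - 1"
    using \<open>l \<noteq> 1\<close> by (simp_all add: c_def d_def divide_simps) (simp_all add: algebra_simps)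
  have "d *\<^sub>C x + c *\<^sub>C T x = ?R x" for x
  proof -
    have "d *\<^sub>C x + c *\<^sub>C T x = (c - c * l) *\<^sub>C P x + (d + c * l) *\<^sub>C x"
      unfolding assms(4)[symmetric]
      by (simp add: complex_module.scale_right_distrib complex_module.scale_left_distrib
          complex_module.scale_right_diff_distrib complex_module.scale_left_diff_distrib)
    then show ?thesis
      by (simp add: c d)
  qed
  then have "?R = poly_op [:d, c:] T"
    by (simp add: poly_op_linear)
  then show "?R \<in> generated_algebra T"
    unfolding generated_algebra_def by (rule range_eqI)
qed

end
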